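(* Let $\mathcal{P}$ be an abstract $n$-polytope all of whose facets are regular. Then $\mathcal{P}$ is hereditary if and only if $\mathcal{P}$ is regular or $\mathcal{P}$ is a $2$-orbit polytope in the class $2_{\{0,1,\ldots,n-2\}}$.
   Context: An abstract $n$-polytope is a partially ordered set $\mathcal{P}$ with a strictly monotone rank function onto $\{-1,0,\ldots,n\}$, with a least face $F_{-1}$ and a greatest face $F_n$, in which every flag (maximal chain) has exactly $n+2$ elements, which is strongly flag-connected, and which satisfies the diamond condition. Facets are the $(n-1)$-faces, identified with sections $F/F_{-1}$. $\Gamma(\mathcal{P})$ is the automorphism group. For a flag $\Phi$ and $0\le i\le n-1$, $\Phi^i$ denotes the unique flag differing from $\Phi$ exactly in its $i$-face. $\mathcal{P}$ is regular if $\Gamma(\mathcal{P})$ is transitive on flags; it is a $2$-orbit polytope if $\Gamma(\mathcal{P})$ has exactly two orbits on flags; a $2$-orbit polytope is in class $2_I$ ($I\subseteq\{0,\ldots,n-1\}$) if for every flag $\Phi$, $\Phi$ and $\Phi^i$ lie in the same orbit exactly when $i\in I$. $\mathcal{P}$ is hereditary if for every facet $F$, every automorphism of $F/F_{-1}$ extends to an automorphism of $\mathcal{P}$ (which then fixes $F$). *)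

theory Defs
  imports "HOL-Library.FuncSet"
begin

text \<open>
  A poset is given by a carrier \<open>P\<close> and a relation \<open>le\<close>, of which only the restriction to \<open>P\<close>
  matters. A section is then a smaller carrier with the same \<open>le\<close>, so that flags, automorphisms
  and regularity apply to it directly.
\<close>

definition flags :: "'a set \<Rightarrow> ('a \<Rightarrow> 'a \<Rightarrow> bool) \<Rightarrow> 'a set set" where
  "flags P le = {\<Phi>. pred_on.maxchain P le \<Phi>}"

definition adjacent :: "'a set \<Rightarrow> 'a set \<Rightarrow> bool" where
  "adjacent \<Phi> \<Psi> \<longleftrightarrow> card (\<Phi> - \<Psi>) = 1 \<and> card (\<Psi> - \<Phi>) = 1"

definition strongly_flag_connected :: "'a set \<Rightarrow> ('a \<Rightarrow> 'a \<Rightarrow> bool) \<Rightarrow> bool" where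
  "strongly_flag_connected P le \<longleftrightarrow>
     (\<forall>\<Phi>\<in>flags P le. \<forall>\<Psi>\<in>flags P le.
        (\<Phi>, \<Psi>) \<in> {(A, B). A \<in> flags P le \<and> B \<in> flags P le \<and> adjacent A B \<and>
                          \<Phi> \<inter> \<Psi> \<subseteq> A \<and> \<Phi> \<inter> \<Psi> \<subseteq> B}\<^sup>*)"

text \<open>
  The rank \<open>n\<close> is an integer; the axioms force \<open>n \<ge> -1\<close>, since the carrier is nonempty.
\<close>

locale abstract_polytope =
  fixes n :: int
    and P :: "'a set"
    and le :: "'a \<Rightarrow> 'a \<Rightarrow> bool"
    and rk :: "'a \<Rightarrow> int"
  assumes le_refl: "reflp_on P le"
    and le_antisym: "antisymp_on P le"
    and le_trans: "transp_on P le"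
    and rank_strict_mono: "monotone_on P (\<lambda>x y. le x y \<and> x \<noteq> y) (<) rk"
    and rank_onto: "rk ` P = {-1..n}"
    and least_face: "\<exists>x\<in>P. \<forall>y\<in>P. le x y"
    and greatest_face: "\<exists>x\<in>P. \<forall>y\<in>P. le y x"
    and card_flag: "\<And>\<Phi>. \<Phi> \<in> flags P le \<Longrightarrow> int (card \<Phi>) = n + 2"
    and strongly_flag_connected: "strongly_flag_connected P le"
    and diamond: "\<And>F G. \<lbrakk>F \<in> P; G \<in> P; le F G; rk G - rk F = 2\<rbrakk> \<Longrightarrow>
          card {H \<in> P. le F H \<and> H \<noteq> F \<and> le H G \<and> H \<noteq> G} = 2"

definition bottom_face :: "'a set \<Rightarrow> ('a \<Rightarrow> 'a \<Rightarrow> bool) \<Rightarrow> 'a" where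
  "bottom_face P le = (THE x. x \<in> P \<and> (\<forall>y\<in>P. le x y))"

definition section_between :: "'a set \<Rightarrow> ('a \<Rightarrow> 'a \<Rightarrow> bool) \<Rightarrow> 'a \<Rightarrow> 'a \<Rightarrow> 'a set" where
  "section_between P le F G = {x \<in> P. le F x \<and> le x G}"

definition facets :: "int \<Rightarrow> 'a set \<Rightarrow> ('a \<Rightarrow> int) \<Rightarrow> 'a set" where
  "facets n P rk = {F \<in> P. rk F = n - 1}"

definition facet_section :: "'a set \<Rightarrow> ('a \<Rightarrow> 'a \<Rightarrow> bool) \<Rightarrow> 'a \<Rightarrow> 'a set" where
  "facet_section P le F = section_between P le (bottom_face P le) F"

definition automorphisms :: "'a set \<Rightarrow> ('a \<Rightarrow> 'a \<Rightarrow> bool) \<Rightarrow> ('a \<Rightarrow> 'a) set" where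
  "automorphisms P le =
     {\<gamma> \<in> extensional P. bij_betw \<gamma> P P \<and> (\<forall>x\<in>P. \<forall>y\<in>P. le (\<gamma> x) (\<gamma> y) \<longleftrightarrow> le x y)}"

definition flag_orbit :: "'a set \<Rightarrow> ('a \<Rightarrow> 'a \<Rightarrow> bool) \<Rightarrow> 'a set \<Rightarrow> 'a set set" where
  "flag_orbit P le \<Phi> = {\<gamma> ` \<Phi> | \<gamma>. \<gamma> \<in> automorphisms P le}"

definition regular :: "'a set \<Rightarrow> ('a \<Rightarrow> 'a \<Rightarrow> bool) \<Rightarrow> bool" where
  "regular P le \<longleftrightarrow> (\<forall>\<Phi>\<in>flags P le. \<forall>\<Psi>\<in>flags P le. \<Psi> \<in> flag_orbit P le \<Phi>)"

definition two_orbit :: "'a set \<Rightarrow> ('a \<Rightarrow> 'a \<Rightarrow> bool) \<Rightarrow> bool" where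
  "two_orbit P le \<longleftrightarrow> card (flag_orbit P le ` flags P le) = 2"

text \<open>
  The flag differing from \<open>\<Phi>\<close> exactly in its \<open>i\<close>-face. In an abstract \<open>n\<close>-polytope it exists and is
  unique for \<open>0 \<le> i \<le> n - 1\<close>, by the diamond condition.
\<close>

definition flag_flip ::
  "'a set \<Rightarrow> ('a \<Rightarrow> 'a \<Rightarrow> bool) \<Rightarrow> ('a \<Rightarrow> int) \<Rightarrow> int \<Rightarrow> 'a set \<Rightarrow> 'a set" where
  "flag_flip P le rk i \<Phi> =
     (THE \<Psi>. \<Psi> \<in> flags P le \<and> \<Psi> \<noteq> \<Phi> \<and> {x \<in> \<Psi>. rk x \<noteq> i} = {x \<in> \<Phi>. rk x \<noteq> i})"

definition in_class_two ::
  "int set \<Rightarrow> int \<Rightarrow> 'a set \<Rightarrow> ('a \<Rightarrow> 'a \<Rightarrow> bool) \<Rightarrow> ('a \<Rightarrow> int) \<Rightarrow> bool" where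
  "in_class_two I n P le rk \<longleftrightarrow>
     I \<subseteq> {0..n - 1} \<and> two_orbit P le \<and>
     (\<forall>\<Phi>\<in>flags P le. \<forall>i\<in>{0..n - 1}. flag_flip P le rk i \<Phi> \<in> flag_orbit P le \<Phi> \<longleftrightarrow> i \<in> I)"

definition hereditary :: "int \<Rightarrow> 'a set \<Rightarrow> ('a \<Rightarrow> 'a \<Rightarrow> bool) \<Rightarrow> ('a \<Rightarrow> int) \<Rightarrow> bool" where
  "hereditary n P le rk \<longleftrightarrow>
     (\<forall>F\<in>facets n P rk. \<forall>\<alpha>\<in>automorphisms (facet_section P le F) le.
        \<exists>\<gamma>\<in>automorphisms P le. \<forall>x\<in>facet_section P le F. \<gamma> x = \<alpha> x)"

end

theory Submission
  imports Defs
begin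

text \<open>
  Both sides are equivalent to the condition that any two flags sharing a facet lie in the same
  orbit. Given this condition, an automorphism \<open>\<alpha>\<close> of a facet and a flag \<open>\<Phi>\<close> through that facet,
  some automorphism \<open>\<gamma>\<close> of the polytope acts on \<open>\<Phi>\<close> as \<open>\<alpha>\<close> does; a map that preserves and reflects
  the order commutes with flips, so agreement spreads along flips within the facet and \<open>\<gamma>\<close>
  extends \<open>\<alpha>\<close>. Also, flips of rank below \<open>n - 1\<close> then stay within an orbit, hence there are at most
  two orbits, that of \<open>\<Phi>\<close> and that of \<open>\<Phi>\<^sup>n\<^sup>-\<^sup>1\<close>; they coincide for one flag only if the polytope is
  regular.
\<close>

section \<open>Automorphisms and flag orbits\<close>

lemma card_2_other:
  assumes "card S = 2" "a \<in> S"
  obtains b where "S = {a, b}" "a \<noteq> b"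
  using assms by (auto simp: card_2_iff)

lemma automorphism_mem:
  assumes "\<gamma> \<in> automorphisms P le" "x \<in> P"
  shows "\<gamma> x \<in> P"
  using assms by (auto simp: automorphisms_def bij_betw_def)

lemma automorphism_le_iff:
  assumes "\<gamma> \<in> automorphisms P le" "x \<in> P" "y \<in> P"
  shows "le (\<gamma> x) (\<gamma> y) \<longleftrightarrow> le x y"
  using assms by (auto simp: automorphisms_def)

lemma flag_orbit_refl:
  assumes "\<Phi> \<subseteq> P"
  shows "\<Phi> \<in> flag_orbit P le \<Phi>"
proof -
  have "restrict id P \<in> automorphisms P le"
    by (auto simp: automorphisms_def bij_betw_def inj_on_def)
  moreover have "restrict id P ` \<Phi> = \<Phi>"
    using assms by (auto simp: image_iff subset_iff)
  ultimately show ?thesis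
    unfolding flag_orbit_def by blast
qed

lemma flag_orbit_sym:
  assumes "\<Phi> \<subseteq> P" "\<Psi> \<in> flag_orbit P le \<Phi>"
  shows "\<Phi> \<in> flag_orbit P le \<Psi>"
proof -
  obtain \<gamma> where \<gamma>: "\<gamma> \<in> automorphisms P le" "\<Psi> = \<gamma> ` \<Phi>"
    using assms by (auto simp: flag_orbit_def)
  then have bij: "bij_betw \<gamma> P P"
    by (simp add: automorphisms_def)
  \<comment> \<open>Automorphisms are required to be extensional, so the inverse has to be cut back
    to \<open>P\<close>.\<close>
  let ?\<delta> = "restrict (the_inv_into P \<gamma>) P"
  have inv: "the_inv_into P \<gamma> x \<in> P" "\<gamma> (the_inv_into P \<gamma> x) = x" if "x \<in> P" for x
    using bij that by (auto simp: bij_betw_def intro: the_inv_into_into f_the_inv_into_f)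
  have "?\<delta> \<in> automorphisms P le"
    unfolding automorphisms_def
  proof (intro CollectI conjI ballI)
    show "bij_betw ?\<delta> P P"
      using bij_betw_the_inv_into[OF bij] by (simp add: bij_betw_def inj_on_def)
    show "le (?\<delta> x) (?\<delta> y) \<longleftrightarrow> le x y" if "x \<in> P" "y \<in> P" for x y
      using automorphism_le_iff[OF \<gamma>(1), of "the_inv_into P \<gamma> x" "the_inv_into P \<gamma> y"] that inv
      by simp
  qed simp
  moreover have "?\<delta> ` \<Psi> = \<Phi>"
  proof -
    have "?\<delta> (\<gamma> x) = x" if "x \<in> \<Phi>" for x
      using that assms(1) bij automorphism_mem[OF \<gamma>(1)]
      by (auto simp: bij_betw_def the_inv_into_f_f)
    then show ?thesis
      unfolding \<gamma>(2) image_image by simp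
  qed
  ultimately show ?thesis
    unfolding flag_orbit_def by blast
qed

lemma flag_orbit_trans:
  assumes "\<Phi> \<subseteq> P" "\<Psi> \<in> flag_orbit P le \<Phi>" "\<Omega> \<in> flag_orbit P le \<Psi>"
  shows "\<Omega> \<in> flag_orbit P le \<Phi>"
proof -
  obtain \<gamma> \<delta> where \<gamma>: "\<gamma> \<in> automorphisms P le" "\<Psi> = \<gamma> ` \<Phi>"
    and \<delta>: "\<delta> \<in> automorphisms P le" "\<Omega> = \<delta> ` \<Psi>"
    using assms by (auto simp: flag_orbit_def)
  have "compose P \<delta> \<gamma> \<in> automorphisms P le"
    using \<gamma>(1) \<delta>(1) bij_betw_compose[of \<gamma> P P \<delta> P]
    by (auto simp: automorphisms_def compose_eq bij_betw_apply)
  moreover have "compose P \<delta> \<gamma> ` \<Phi> = \<Omega>"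
    unfolding \<gamma>(2) \<delta>(2) image_image
    using assms(1) by (intro image_cong) (auto simp: compose_eq)
  ultimately show ?thesis
    unfolding flag_orbit_def by blast
qed

lemma flag_orbit_eq:
  assumes "\<Phi> \<subseteq> P" "\<Psi> \<in> flag_orbit P le \<Phi>"
  shows "flag_orbit P le \<Psi> = flag_orbit P le \<Phi>"
proof -
  have "\<Psi> \<subseteq> P"
    using assms by (auto simp: flag_orbit_def dest: automorphism_mem)
  then show ?thesis
    using assms flag_orbit_sym flag_orbit_trans by blast
qed

section \<open>Chains, flags and ranks\<close>

context abstract_polytope
begin

text \<open>The reflexive closure in \<open>pred_on.chain\<close> is dropped because
  \<open>le\<close> is already reflexive on \<open>P\<close>.\<close>

definition is_chain :: "'a set \<Rightarrow> bool" where
  "is_chain C \<longleftrightarrow> C \<subseteq> P \<and> (\<forall>x\<in>C. \<forall>y\<in>C. le x y \<or> le y x)"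

lemma face_refl: "x \<in> P \<Longrightarrow> le x x"
  using le_refl by (simp add: reflp_on_def)

lemma face_antisym: "x \<in> P \<Longrightarrow> y \<in> P \<Longrightarrow> le x y \<Longrightarrow> le y x \<Longrightarrow> x = y"
  using le_antisym by (auto simp: antisymp_on_def)

lemma face_trans: "x \<in> P \<Longrightarrow> y \<in> P \<Longrightarrow> z \<in> P \<Longrightarrow> le x y \<Longrightarrow> le y z \<Longrightarrow> le x z"
  using le_trans unfolding transp_on_def by blast

lemma rk_less: "x \<in> P \<Longrightarrow> y \<in> P \<Longrightarrow> le x y \<Longrightarrow> x \<noteq> y \<Longrightarrow> rk x < rk y"
  using rank_strict_mono by (auto simp: monotone_on_def)

lemma rk_range: "x \<in> P \<Longrightarrow> rk x \<in> {-1..n}"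
  using rank_onto by blast

lemma chain_rk_le_iff:
  assumes "is_chain C" "x \<in> C" "y \<in> C"
  shows "le x y \<longleftrightarrow> rk x \<le> rk y"
  using assms rk_less[of x y] rk_less[of y x] face_refl[of x]
  unfolding is_chain_def by (cases "x = y") (fastforce)+

lemma chain_inj_rk: "is_chain C \<Longrightarrow> inj_on rk C"
  by (rule inj_onI) (metis face_antisym chain_rk_le_iff is_chain_def order_refl subset_iff)

lemma chain_finite: "is_chain C \<Longrightarrow> finite C"
  by (rule inj_on_finite[OF chain_inj_rk, of C "{-1..n}"]) (auto simp: is_chain_def dest!: subsetD rk_range)

lemma card_rk_chain: "is_chain C \<Longrightarrow> card (rk ` C) = card C"
  by (simp add: card_image chain_inj_rk)

lemma rk_chain_subset: "is_chain C \<Longrightarrow> rk ` C \<subseteq> {-1..n}"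
  using rank_onto by (auto simp: is_chain_def)

lemma chain_card_le: "is_chain C \<Longrightarrow> card C \<le> nat (n + 2)"
  using card_mono[OF _ rk_chain_subset, of C] by (simp add: card_rk_chain)

lemma pred_on_chain_iff: "Q \<subseteq> P \<Longrightarrow> pred_on.chain Q le C \<longleftrightarrow> C \<subseteq> Q \<and> is_chain C"
  unfolding pred_on.chain_def is_chain_def using face_refl by blast

lemma chain_mono: "is_chain D \<Longrightarrow> C \<subseteq> D \<Longrightarrow> is_chain C"
  by (auto simp: is_chain_def)

lemma rank_ge: "n \<ge> -1"
  using rk_range least_face by (metis atLeastAtMost_iff order_trans)

text \<open>Chains have at most \<open>n + 2\<close> faces, so among the chains in \<open>Q\<close>
  containing \<open>C\<close> there is one of greatest cardinality, and it is maximal.\<close>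

lemma chain_extends:
  assumes "Q \<subseteq> P" "C \<subseteq> Q" "is_chain C"
  obtains \<Phi> where "\<Phi> \<in> flags Q le" "C \<subseteq> \<Phi>"
proof -
  let ?ok = "\<lambda>D. C \<subseteq> D \<and> D \<subseteq> Q \<and> is_chain D"
  have "?ok C" using assms by simp
  then obtain D where D: "?ok D" "\<And>E. ?ok E \<Longrightarrow> card E \<le> card D"
    using ex_has_greatest_nat[of ?ok C card "nat (n + 2) + 1"] chain_card_le
    by (metis (no_types, lifting) Suc_eq_plus1 le_imp_less_Suc)
  have "\<not> D \<subset> E" if "E \<subseteq> Q" "is_chain E" for E
    using D that psubset_card_mono[of E D] chain_finite[of E] by (metis leD order_trans psubset_imp_subset)
  then have "D \<in> flags Q le"
    using D(1) assms(1) by (auto simp: flags_def pred_on.maxchain_def pred_on_chain_iff)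
  with D(1) show ?thesis using that by blast
qed

text \<open>A chain with \<open>n + 2\<close> faces extends to a flag, which has the same finite
  cardinality and hence equals the chain. Being a flag thus becomes a matter of counting.\<close>

lemma flag_iff: "\<Phi> \<in> flags P le \<longleftrightarrow> is_chain \<Phi> \<and> int (card \<Phi>) = n + 2"
proof
  assume "\<Phi> \<in> flags P le"
  then show "is_chain \<Phi> \<and> int (card \<Phi>) = n + 2"
    using card_flag[of \<Phi>] by (auto simp: flags_def pred_on.maxchain_def pred_on_chain_iff)
next
  assume A: "is_chain \<Phi> \<and> int (card \<Phi>) = n + 2"
  then obtain \<Psi> where \<Psi>: "\<Psi> \<in> flags P le" "\<Phi> \<subseteq> \<Psi>"
    using chain_extends[of P \<Phi>] by (auto simp: is_chain_def)
  moreover have "is_chain \<Psi>"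
    using \<Psi>(1) by (auto simp: flags_def pred_on.maxchain_def pred_on_chain_iff)
  moreover have "card \<Phi> = card \<Psi>"
    using A card_flag[OF \<Psi>(1)] by simp
  ultimately have "\<Phi> = \<Psi>"
    using card_subset_eq chain_finite by blast
  with \<Psi>(1) show "\<Phi> \<in> flags P le" by simp
qed

lemma flag_chain: "\<Phi> \<in> flags P le \<Longrightarrow> is_chain \<Phi>"
  by (simp add: flag_iff)

lemma flag_maximal: "\<Phi> \<in> flags P le \<Longrightarrow> is_chain C \<Longrightarrow> \<not> \<Phi> \<subset> C"
  by (simp add: flags_def pred_on.maxchain_def pred_on_chain_iff) (simp add: is_chain_def)

lemma flag_subset: "\<Phi> \<in> flags P le \<Longrightarrow> \<Phi> \<subseteq> P"
  using flag_chain by (auto simp: is_chain_def)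

lemma flag_rk_image:
  assumes "\<Phi> \<in> flags P le"
  shows "rk ` \<Phi> = {-1..n}"
  using assms rank_ge
  by (intro card_subset_eq rk_chain_subset) (auto simp: flag_iff card_rk_chain)

lemma flag_rk_inj: "\<Phi> \<in> flags P le \<Longrightarrow> x \<in> \<Phi> \<Longrightarrow> y \<in> \<Phi> \<Longrightarrow> rk x = rk y \<Longrightarrow> x = y"
  using chain_inj_rk[OF flag_chain] by (auto simp: inj_on_def)

lemma flag_minus_face:
  assumes "\<Phi> \<in> flags P le" "x \<in> \<Phi>" "rk x = i"
  shows "\<Phi> - {x} = {y \<in> \<Phi>. rk y \<noteq> i}"
proof -
  have "\<And>y. y \<in> \<Phi> \<Longrightarrow> rk y = i \<longleftrightarrow> y = x"
    using flag_rk_inj[OF assms(1) _ assms(2)] assms(3) by metis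
  then show ?thesis
    by blast
qed

lemma flag_face:
  assumes "\<Phi> \<in> flags P le" "i \<in> {-1..n}"
  obtains x where "x \<in> \<Phi>" "rk x = i"
  using flag_rk_image[OF assms(1)] assms(2) by (metis (no_types, lifting) imageE)

text \<open>Every face other than the least one has rank strictly above that of the least face,
  which is at least -1.\<close>

lemma rank_minus_one_unique: "x \<in> P \<Longrightarrow> y \<in> P \<Longrightarrow> rk x = -1 \<Longrightarrow> rk y = -1 \<Longrightarrow> x = y"
  using least_face rk_less rk_range by (metis atLeastAtMost_iff linorder_not_less)

lemma rank_n_unique: "x \<in> P \<Longrightarrow> y \<in> P \<Longrightarrow> rk x = n \<Longrightarrow> rk y = n \<Longrightarrow> x = y"
  using greatest_face rk_less rk_range by (metis atLeastAtMost_iff linorder_not_less)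

text \<open>The faces of a flag below \<open>x\<close> have exactly the ranks from -1 to
  \<open>rk x\<close>, each once. This recovers the rank from the order alone, so that maps
  respecting the order can be shown to preserve ranks.\<close>

lemma card_below_flag_face:
  assumes "\<Phi> \<in> flags P le" "x \<in> \<Phi>"
  shows "int (card {y \<in> \<Phi>. le y x}) = rk x + 2"
proof -
  have "{y \<in> \<Phi>. le y x} = {y \<in> \<Phi>. rk y \<le> rk x}"
    using assms by (auto simp: chain_rk_le_iff[OF flag_chain])
  moreover have "rk ` {y \<in> \<Phi>. rk y \<le> rk x} = {-1..rk x}"
  proof -
    have "rk ` {y \<in> \<Phi>. rk y \<le> rk x} = {i \<in> rk ` \<Phi>. i \<le> rk x}"
      by auto
    also have "\<dots> = {-1..rk x}"
      using assms rk_range[of x] flag_subset[of \<Phi>] by (auto simp: flag_rk_image)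
    finally show ?thesis .
  qed
  moreover have "inj_on rk {y \<in> \<Phi>. rk y \<le> rk x}"
    using assms(1) by (auto intro: inj_on_subset[OF chain_inj_rk[OF flag_chain]])
  moreover have "rk x \<ge> -1"
    using assms rk_range[of x] flag_subset[of \<Phi>] by auto
  ultimately show ?thesis
    using card_image[of rk "{y \<in> \<Phi>. rk y \<le> rk x}"] by simp
qed

section \<open>Order embeddings and their action on flags\<close>

text \<open>Partial maps are allowed so that one notion covers both the automorphisms of the
  polytope and the automorphisms of a facet extended by the greatest face.\<close>

definition embeds :: "'a set \<Rightarrow> ('a \<Rightarrow> 'a) \<Rightarrow> bool" where
  "embeds T f \<longleftrightarrow> T \<subseteq> P \<and> f ` T \<subseteq> P \<and> (\<forall>x\<in>T. \<forall>y\<in>T. le (f x) (f y) \<longleftrightarrow> le x y)"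

lemma embeds_mono: "embeds T f \<Longrightarrow> U \<subseteq> T \<Longrightarrow> embeds U f"
  unfolding embeds_def by blast

lemma automorphism_embeds: "\<gamma> \<in> automorphisms P le \<Longrightarrow> embeds P \<gamma>"
  by (auto simp: embeds_def automorphism_mem automorphism_le_iff)

lemma embeds_inj:
  assumes "embeds T f"
  shows "inj_on f T"
proof (rule inj_onI)
  fix x y assume xy: "x \<in> T" "y \<in> T" "f x = f y"
  then have "le (f x) (f y)" "le (f y) (f x)"
    using assms face_refl[of "f x"] by (auto simp: embeds_def)
  then show "x = y"
    using assms xy(1,2) face_antisym[of x y] by (auto simp: embeds_def)
qed

text \<open>The image is a chain, and injectivity gives it the full number of faces.\<close>

lemma embeds_flag:
  assumes "embeds T f" "\<Phi> \<in> flags P le" "\<Phi> \<subseteq> T"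
  shows "f ` \<Phi> \<in> flags P le"
proof -
  have "is_chain (f ` \<Phi>)"
    unfolding is_chain_def
  proof (intro conjI ballI)
    show "f ` \<Phi> \<subseteq> P"
      using assms(1,3) by (auto simp: embeds_def)
    fix u v assume "u \<in> f ` \<Phi>" "v \<in> f ` \<Phi>"
    then obtain x y where "u = f x" "v = f y" "x \<in> \<Phi>" "y \<in> \<Phi>"
      by blast
    then show "le u v \<or> le v u"
      using assms(1,3) flag_chain[OF assms(2)] by (simp add: embeds_def is_chain_def subset_iff)
  qed
  moreover have "card (f ` \<Phi>) = card \<Phi>"
    using assms embeds_inj by (blast intro: card_image inj_on_subset)
  ultimately show ?thesis
    using assms(2) by (simp add: flag_iff)
qed

text \<open>The rank of \<open>x\<close> is determined by the number of faces of the flag below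
  \<open>x\<close>, and \<open>f\<close> carries these bijectively to the faces of the image flag
  below \<open>f x\<close>.\<close>

lemma embeds_rk:
  assumes "embeds T f" "\<Phi> \<in> flags P le" "\<Phi> \<subseteq> T" "x \<in> \<Phi>"
  shows "rk (f x) = rk x"
proof -
  have "{z \<in> f ` \<Phi>. le z (f x)} = f ` {y \<in> \<Phi>. le y x}"
    using assms unfolding embeds_def by blast
  moreover have "card (f ` {y \<in> \<Phi>. le y x}) = card {y \<in> \<Phi>. le y x}"
    using assms embeds_inj by (blast intro: card_image inj_on_subset)
  ultimately show ?thesis
    using card_below_flag_face[OF assms(2,4)] assms(4)
      card_below_flag_face[OF embeds_flag[OF assms(1-3)], of "f x"] by simp
qed

text \<open>Both \<open>f x\<close> and \<open>g x\<close> are the face of rank \<open>rk x\<close>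
  in the same flag.\<close>

lemma embeds_eq_of_image_eq:
  assumes "embeds T f" "embeds T g" "\<Phi> \<in> flags P le" "\<Phi> \<subseteq> T" "f ` \<Phi> = g ` \<Phi>" "x \<in> \<Phi>"
  shows "f x = g x"
  using flag_rk_inj[OF embeds_flag[OF assms(1,3,4)], of "f x" "g x"] assms
    embeds_rk[OF assms(1,3,4,6)] embeds_rk[OF assms(2,3,4,6)] by auto

section \<open>Flips of flags and connectivity\<close>

text \<open>The relation underlying the definite description in \<open>flag_flip\<close>, usable
  without existence and uniqueness of the flip.\<close>

definition flip_rel :: "int \<Rightarrow> 'a set \<Rightarrow> 'a set \<Rightarrow> bool" where
  "flip_rel i \<Phi> \<Psi> \<longleftrightarrow> \<Psi> \<in> flags P le \<and> \<Psi> \<noteq> \<Phi> \<and> {x \<in> \<Psi>. rk x \<noteq> i} = {x \<in> \<Phi>. rk x \<noteq> i}"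

lemma flip_rel_sym: "\<Phi> \<in> flags P le \<Longrightarrow> flip_rel i \<Phi> \<Psi> \<Longrightarrow> flip_rel i \<Psi> \<Phi>"
  by (auto simp: flip_rel_def)

text \<open>By the diamond condition, exactly two faces lie strictly between the faces
  \<open>l\<close> and \<open>h\<close> of \<open>A\<close> of ranks \<open>i - 1\<close> and
  \<open>i + 1\<close>: the face \<open>a\<close> of \<open>A\<close> and one other face
  \<open>b\<close>. The flip exchanges \<open>a\<close> for \<open>b\<close>.\<close>

lemma ex1_flip_rel:
  assumes A: "A \<in> flags P le" and i: "i \<in> {0..n - 1}"
  shows "\<exists>!B. flip_rel i A B"
proof -
  obtain l where l: "l \<in> A" "rk l = i - 1"
    using flag_face[OF A, of "i - 1"] i by auto
  obtain a where a: "a \<in> A" "rk a = i"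
    using flag_face[OF A, of "i"] i by auto
  obtain h where h: "h \<in> A" "rk h = i + 1"
    using flag_face[OF A, of "i + 1"] i by auto
  have le_iff: "\<And>x y. x \<in> A \<Longrightarrow> y \<in> A \<Longrightarrow> le x y \<longleftrightarrow> rk x \<le> rk y"
    using chain_rk_le_iff[OF flag_chain[OF A]] .
  have AP: "\<And>x. x \<in> A \<Longrightarrow> x \<in> P"
    using flag_subset[OF A] by blast
  let ?D = "{H \<in> P. le l H \<and> H \<noteq> l \<and> le H h \<and> H \<noteq> h}"
  have "card ?D = 2"
    using l h AP by (intro diamond) (auto simp: le_iff)
  moreover have "a \<in> ?D"
    using l a h AP by (auto simp: le_iff)
  ultimately obtain b where D: "?D = {a, b}" and ab: "a \<noteq> b"
    by (elim card_2_other)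
  have "b \<in> ?D"
    unfolding D by simp
  then have b: "b \<in> P" "le l b" "le b h" "b \<noteq> l" "b \<noteq> h"
    by auto
  have rk_b: "rk b = i"
    using rk_less[of l b] rk_less[of b h] b l h AP by auto
  have b_notin: "b \<notin> A"
    using flag_rk_inj[OF A a(1), of b] ab a(2) rk_b by auto
  define B where "B = insert b (A - {a})"
  \<comment> \<open>Every face of \<open>A\<close> other than \<open>a\<close> is below
    \<open>l\<close> or above \<open>h\<close>, hence comparable with \<open>b\<close>.\<close>
  have cmp: "le x b \<or> le b x" if "x \<in> A" "x \<noteq> a" for x
  proof -
    have "rk x \<noteq> i"
      using flag_rk_inj[OF A that(1) a(1)] that a by auto
    then have "le x l \<or> le h x"
      using that l h by (auto simp: le_iff)
    then show ?thesis
      using face_trans[of x l b] face_trans[of b h x] b l h AP that by blast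
  qed
  have "is_chain B"
    using flag_chain[OF A] cmp b(1) face_refl[of b] unfolding is_chain_def B_def by blast
  moreover have "card B = card A"
    using b_notin a chain_finite[OF flag_chain[OF A]] card.remove[of A a] by (simp add: B_def)
  ultimately have "B \<in> flags P le"
    using A by (simp add: flag_iff)
  moreover have "{x \<in> B. rk x \<noteq> i} = {x \<in> A. rk x \<noteq> i}"
    using rk_b a by (auto simp: B_def)
  ultimately have "flip_rel i A B"
    using b_notin by (auto simp: flip_rel_def B_def)
  \<comment> \<open>\<open>C\<close> also contains \<open>l\<close> and \<open>h\<close>, so its
    face of rank \<open>i\<close> is \<open>a\<close> or \<open>b\<close>; the choice
    \<open>a\<close> would give \<open>C = A\<close>.\<close>
  moreover have "C = B" if C: "flip_rel i A C" for C
  proof -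
    have CF: "C \<in> flags P le" and CA: "C \<noteq> A" and eq: "{x \<in> C. rk x \<noteq> i} = {x \<in> A. rk x \<noteq> i}"
      using C by (auto simp: flip_rel_def)
    obtain c where c: "c \<in> C" "rk c = i"
      using flag_face[OF CF, of i] i by auto
    have "{l, h} \<subseteq> {x \<in> C. rk x \<noteq> i}"
      unfolding eq using l h by simp
    then have "c \<in> ?D"
      using c l h flag_subset[OF CF] by (auto simp: chain_rk_le_iff[OF flag_chain[OF CF]])
    then have "c = a \<or> c = b"
      unfolding D by simp
    moreover have "insert b {x \<in> A. rk x \<noteq> i} = B"
      unfolding B_def flag_minus_face[OF A a] ..
    ultimately show ?thesis
      using eq CA insert_Diff[OF a(1)] insert_Diff[OF c(1)]
        flag_minus_face[OF A a] flag_minus_face[OF CF c] by metis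
  qed
  ultimately show ?thesis
    by blast
qed

lemma flip_rel_flag_flip:
  assumes "A \<in> flags P le" "i \<in> {0..n - 1}"
  shows "flip_rel i A (flag_flip P le rk i A)"
  using theI'[OF ex1_flip_rel[OF assms]] by (simp add: flip_rel_def flag_flip_def)

lemma flip_rel_imp_eq:
  assumes "A \<in> flags P le" "i \<in> {0..n - 1}" "flip_rel i A B" "flip_rel i A C"
  shows "B = C"
  using ex1_flip_rel[OF assms(1,2)] assms(3,4) by blast

text \<open>Each flag has one face of every rank, so the single faces \<open>a\<close> and
  \<open>b\<close> in which the two flags differ have equal rank.\<close>

lemma adjacent_imp_flip_rel:
  assumes A: "A \<in> flags P le" and B: "B \<in> flags P le" and adj: "adjacent A B"
  obtains i where "i \<in> {0..n - 1}" "flip_rel i A B" "\<forall>x\<in>A \<inter> B. rk x \<noteq> i"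
proof -
  obtain a b where a: "A - B = {a}" and b: "B - A = {b}"
    using adj by (auto simp: adjacent_def card_1_singleton_iff)
  have aA: "a \<in> A" "a \<notin> B" and bB: "b \<in> B" "b \<notin> A"
    using a b by auto
  have AP: "a \<in> P" and BP: "b \<in> P"
    using aA bB flag_subset A B by auto
  obtain y where y: "y \<in> B" "rk y = rk a"
    using flag_face[OF B rk_range[OF AP]] .
  then have "y \<notin> A"
    using flag_rk_inj[OF A aA(1), of y] aA by auto
  then have rk_b: "rk b = rk a"
    using y b by auto
  show ?thesis
  proof
    \<comment> \<open>The ranks -1 and \<open>n\<close> are excluded because each is attained by
      only one face, while \<open>a\<close> and \<open>b\<close> differ.\<close>
    show "rk a \<in> {0..n - 1}"
      using rank_minus_one_unique[OF AP BP] rank_n_unique[OF AP BP] rk_b aA bB rk_range[OF AP] by force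
    show "\<forall>x\<in>A \<inter> B. rk x \<noteq> rk a"
      using flag_rk_inj[OF A aA(1)] aA by (metis IntD1 IntD2)
    show "flip_rel (rk a) A B"
      unfolding flip_rel_def
    proof (intro conjI)
      have "\<And>x. x \<in> A \<Longrightarrow> rk x \<noteq> rk a \<Longrightarrow> x \<in> B" "\<And>x. x \<in> B \<Longrightarrow> rk x \<noteq> rk a \<Longrightarrow> x \<in> A"
        using a b rk_b by (metis DiffI singletonD)+
      then show "{x \<in> B. rk x \<noteq> rk a} = {x \<in> A. rk x \<noteq> rk a}"
        by blast
    qed (use B aA in auto)
  qed
qed

text \<open>Strong flag-connectedness as an induction principle. Every flag on the path keeps the
  common faces of \<open>\<Phi>\<close> and \<open>\<Psi>\<close>, so no flip takes place at the
  rank of a common face; for flags sharing a facet this rules out flips of rank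
  \<open>n - 1\<close>.\<close>

lemma flag_path_induct [consumes 2, case_names start step]:
  assumes \<Phi>: "\<Phi> \<in> flags P le" and \<Psi>: "\<Psi> \<in> flags P le"
    and start: "Q \<Phi>"
    and step: "\<And>A B i. \<lbrakk>A \<in> flags P le; B \<in> flags P le; \<Phi> \<inter> \<Psi> \<subseteq> A; \<Phi> \<inter> \<Psi> \<subseteq> B; Q A;
          i \<in> {0..n - 1}; flip_rel i A B; \<forall>x\<in>\<Phi> \<inter> \<Psi>. rk x \<noteq> i\<rbrakk> \<Longrightarrow> Q B"
  shows "Q \<Psi>"
proof -
  let ?R = "{(A, B). A \<in> flags P le \<and> B \<in> flags P le \<and> adjacent A B \<and>
      \<Phi> \<inter> \<Psi> \<subseteq> A \<and> \<Phi> \<inter> \<Psi> \<subseteq> B}"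
  have "(\<Phi>, \<Psi>) \<in> ?R\<^sup>*"
    using strongly_flag_connected \<Phi> \<Psi> unfolding strongly_flag_connected_def by blast
  then show ?thesis
  proof (induction rule: rtrancl_induct)
    case base
    show ?case by (rule start)
  next
    case (step A B)
    then have AB: "A \<in> flags P le" "B \<in> flags P le" "adjacent A B" "\<Phi> \<inter> \<Psi> \<subseteq> A" "\<Phi> \<inter> \<Psi> \<subseteq> B"
      by auto
    obtain i where "i \<in> {0..n - 1}" "flip_rel i A B" "\<forall>x\<in>A \<inter> B. rk x \<noteq> i"
      using adjacent_imp_flip_rel[OF AB(1-3)] .
    then show ?case
      using AB step.IH assms(4)[of A B i] by blast
  qed
qed

lemma embeds_flip_rel:
  assumes f: "embeds T f" and A: "A \<in> flags P le" and sub: "A \<subseteq> T" "B \<subseteq> T"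
    and flip: "flip_rel i A B"
  shows "flip_rel i (f ` A) (f ` B)"
proof -
  have B: "B \<in> flags P le"
    using flip by (simp add: flip_rel_def)
  have img: "{x \<in> f ` C. rk x \<noteq> i} = f ` {x \<in> C. rk x \<noteq> i}" if "C \<in> flags P le" "C \<subseteq> T" for C
    using embeds_rk[OF f that] by auto
  have "f ` B \<noteq> f ` A"
    using flip sub inj_on_image_eq_iff[OF embeds_inj[OF f]] by (auto simp: flip_rel_def)
  then show ?thesis
    using embeds_flag[OF f B sub(2)] flip img A B sub by (simp add: flip_rel_def)
qed

text \<open>The automorphism carrying \<open>A\<close> to \<open>B\<close> carries the flip of
  \<open>A\<close> to a flip of \<open>B\<close>, which is \<open>B'\<close> by uniqueness.\<close>

lemma flip_rel_flag_orbit: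
  assumes A: "A \<in> flags P le" and B: "B \<in> flag_orbit P le A" and i: "i \<in> {0..n - 1}"
    and flips: "flip_rel i A A'" "flip_rel i B B'"
  shows "B' \<in> flag_orbit P le A'"
proof -
  obtain \<gamma> where \<gamma>: "\<gamma> \<in> automorphisms P le" "B = \<gamma> ` A"
    using B by (auto simp: flag_orbit_def)
  note emb = automorphism_embeds[OF \<gamma>(1)]
  have A': "A' \<in> flags P le"
    using flips by (simp add: flip_rel_def)
  have "flip_rel i B (\<gamma> ` A')"
    unfolding \<gamma>(2) using embeds_flip_rel[OF emb A] A A' flag_subset flips(1) by blast
  moreover have "B \<in> flags P le"
    unfolding \<gamma>(2) using embeds_flag[OF emb A] flag_subset[OF A] by blast
  ultimately have "B' = \<gamma> ` A'"
    using flip_rel_imp_eq i flips(2) by blast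
  then show ?thesis
    using \<gamma>(1) unfolding flag_orbit_def by blast
qed

text \<open>Rigidity: the path from \<open>\<Phi>\<close> to \<open>\<Psi>\<close> stays among flags
  containing \<open>F\<close>, hence inside \<open>T\<close>. Once \<open>f\<close> and
  \<open>g\<close> agree on \<open>A\<close>, uniqueness of flips makes the images of the next flag
  equal, and then ranks force agreement face by face.\<close>

lemma embeds_agree:
  assumes f: "embeds T f" and g: "embeds T g"
    and T: "\<And>A. A \<in> flags P le \<Longrightarrow> F \<in> A \<Longrightarrow> A \<subseteq> T"
    and \<Phi>: "\<Phi> \<in> flags P le" "F \<in> \<Phi>" and \<Psi>: "\<Psi> \<in> flags P le" "F \<in> \<Psi>"
    and agree: "\<forall>x\<in>\<Phi>. f x = g x"
  shows "\<forall>x\<in>\<Psi>. f x = g x"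
  using \<Phi>(1) \<Psi>(1)
proof (induction rule: flag_path_induct)
  case start
  show ?case by (rule agree)
next
  case (step A B i)
  have sub: "A \<subseteq> T" "B \<subseteq> T"
    using T[of A] T[of B] step(1-4) \<Phi>(2) \<Psi>(2) by blast+
  have "f ` A = g ` A"
    using step by auto
  then have "flip_rel i (f ` A) (f ` B)" "flip_rel i (f ` A) (g ` B)"
    using embeds_flip_rel[OF f _ sub] embeds_flip_rel[OF g _ sub] step by auto
  then have "f ` B = g ` B"
    using flip_rel_imp_eq embeds_flag[OF f _ sub(1)] step by blast
  then show ?case
    using embeds_eq_of_image_eq[OF f g _ sub(2)] step by blast
qed

section \<open>The greatest face and the facet sections\<close>

definition top_face :: 'a where
  "top_face = (SOME x. x \<in> P \<and> (\<forall>y\<in>P. le y x))"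

lemma top_face: "top_face \<in> P" "y \<in> P \<Longrightarrow> le y top_face"
  using someI_ex[OF greatest_face[unfolded Bex_def]] by (auto simp: top_face_def)

lemma rk_top_face: "rk top_face = n"
proof -
  obtain x where "x \<in> P" "rk x = n"
    using rank_onto rank_ge by (metis atLeastAtMost_iff imageE order_refl)
  then show ?thesis
    using rk_less[of x top_face] top_face rk_range[of top_face] by fastforce
qed

lemma top_face_in_flag: "\<Phi> \<in> flags P le \<Longrightarrow> top_face \<in> \<Phi>"
  using flag_face[of \<Phi> n] rank_n_unique[OF top_face(1) _ rk_top_face] flag_subset rank_ge
  by (metis atLeastAtMost_iff order_refl subsetD)

lemma facet_section_eq:
  assumes "F \<in> P"
  shows "facet_section P le F = {x \<in> P. le x F}"
proof -
  have "bottom_face P le \<in> P \<and> (\<forall>y\<in>P. le (bottom_face P le) y)"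
    unfolding bottom_face_def by (rule theI') (use least_face face_antisym in blast)
  then show ?thesis
    by (auto simp: facet_section_def section_between_def)
qed

lemma facetD: "F \<in> facets n P rk \<Longrightarrow> F \<in> P \<and> rk F = n - 1"
  by (simp add: facets_def)

lemma top_face_notin_facet_section:
  assumes "F \<in> facets n P rk"
  shows "top_face \<notin> facet_section P le F"
  using facetD[OF assms] top_face rk_top_face face_antisym[of F top_face]
  by (auto simp: facet_section_eq)

lemma flag_subset_facet_section:
  assumes F: "F \<in> facets n P rk" and A: "A \<in> flags P le" "F \<in> A"
  shows "A \<subseteq> insert top_face (facet_section P le F)"
proof
  fix x assume x: "x \<in> A"
  then have P: "x \<in> P"
    using flag_subset[OF A(1)] by blast
  show "x \<in> insert top_face (facet_section P le F)"
  proof (cases "rk x = n")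
    case True
    then show ?thesis
      using rank_n_unique[OF P top_face(1)] rk_top_face by simp
  next
    case False
    then have "le x F"
      using x A facetD[OF F] rk_range[OF P] by (auto simp: chain_rk_le_iff[OF flag_chain])
    then show ?thesis
      using P facetD[OF F] by (simp add: facet_section_eq)
  qed
qed

text \<open>A larger chain in the section would, after adding \<open>top_face\<close>, be a chain of
  the polytope properly containing \<open>A\<close>.\<close>

lemma flag_minus_top_face:
  assumes F: "F \<in> facets n P rk" and A: "A \<in> flags P le" "F \<in> A"
  shows "A - {top_face} \<in> flags (facet_section P le F) le"
proof -
  let ?S = "facet_section P le F"
  have SP: "?S \<subseteq> P"
    using facetD[OF F] by (auto simp: facet_section_eq)
  have "\<not> A - {top_face} \<subset> D" if D: "D \<subseteq> ?S" "is_chain D" for D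
  proof
    assume "A - {top_face} \<subset> D"
    then have "A \<subset> insert top_face D"
      using top_face_notin_facet_section[OF F] D(1) by blast
    moreover have "is_chain (insert top_face D)"
      using D(2) top_face unfolding is_chain_def by blast
    ultimately show False
      using flag_maximal[OF A(1)] by blast
  qed
  moreover have "is_chain (A - {top_face})"
    using chain_mono[OF flag_chain[OF A(1)]] by blast
  moreover have "A - {top_face} \<subseteq> ?S"
    using flag_subset_facet_section[OF F A] by blast
  ultimately show ?thesis
    by (auto simp: flags_def pred_on.maxchain_def pred_on_chain_iff[OF SP])
qed

section \<open>Hereditary polytopes and transitivity on flags through a facet\<close>

text \<open>Automorphisms preserve rank, so one that carries \<open>\<Phi>\<close> to
  \<open>\<Psi>\<close> fixes the common facet \<open>F\<close>. The condition thus says that the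
  stabilizer of each facet is transitive on the flags through it.\<close>

definition facet_transitive :: bool where
  "facet_transitive \<longleftrightarrow> (\<forall>F\<in>facets n P rk. \<forall>\<Phi>\<in>flags P le. \<forall>\<Psi>\<in>flags P le.
     F \<in> \<Phi> \<longrightarrow> F \<in> \<Psi> \<longrightarrow> \<Psi> \<in> flag_orbit P le \<Phi>)"

text \<open>Regularity of the facet supplies an automorphism matching the two flags without their
  greatest face; its extension to the polytope matches the full flags.\<close>

lemma hereditary_imp_facet_transitive:
  assumes hered: "hereditary n P le rk"
    and reg: "\<And>F. F \<in> facets n P rk \<Longrightarrow> regular (facet_section P le F) le"
  shows facet_transitive
  unfolding facet_transitive_def
proof (intro ballI impI)
  fix F \<Phi> \<Psi>
  assume F: "F \<in> facets n P rk" and \<Phi>: "\<Phi> \<in> flags P le" "F \<in> \<Phi>" and \<Psi>: "\<Psi> \<in> flags P le" "F \<in> \<Psi>"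
  obtain \<alpha> where \<alpha>: "\<alpha> \<in> automorphisms (facet_section P le F) le"
    "\<Psi> - {top_face} = \<alpha> ` (\<Phi> - {top_face})"
    using reg[OF F] flag_minus_top_face[OF F \<Phi>] flag_minus_top_face[OF F \<Psi>]
    unfolding regular_def flag_orbit_def by blast
  obtain \<gamma> where \<gamma>: "\<gamma> \<in> automorphisms P le" "\<forall>x\<in>facet_section P le F. \<gamma> x = \<alpha> x"
    using hered F \<alpha>(1) unfolding hereditary_def by blast
  have "\<gamma> ` (\<Phi> - {top_face}) = \<Psi> - {top_face}"
    unfolding \<alpha>(2) using \<gamma>(2) flag_subset_facet_section[OF F \<Phi>] by (intro image_cong) auto
  \<comment> \<open>\<open>\<gamma>\<close> preserves ranks, and only one face has rank
    \<open>n\<close>.\<close>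
  moreover have "\<gamma> top_face = top_face"
    using embeds_rk[OF automorphism_embeds[OF \<gamma>(1)] \<Phi>(1) flag_subset[OF \<Phi>(1)]]
      top_face_in_flag[OF \<Phi>(1)] top_face(1) rk_top_face automorphism_mem[OF \<gamma>(1)] rank_n_unique
    by metis
  ultimately have "\<gamma> ` \<Phi> = \<Psi>"
    using top_face_in_flag[OF \<Phi>(1)] top_face_in_flag[OF \<Psi>(1)] by (metis image_insert insert_Diff)
  then show "\<Psi> \<in> flag_orbit P le \<Phi>"
    using \<gamma>(1) unfolding flag_orbit_def by blast
qed

lemma facet_transitive_imp_hereditary:
  assumes trans: facet_transitive
  shows "hereditary n P le rk"
  unfolding hereditary_def
proof (intro ballI)
  fix F \<alpha>
  let ?S = "facet_section P le F"
  assume F: "F \<in> facets n P rk" and \<alpha>: "\<alpha> \<in> automorphisms ?S le"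
  note FP = facetD[OF F]
  note S = facet_section_eq[OF conjunct1[OF FP]]
  define T where "T = insert top_face ?S"
  \<comment> \<open>Fixing \<open>top_face\<close> extends \<open>\<alpha>\<close> to a set that
    contains every flag of the polytope through \<open>F\<close>, so the results on flags apply to
    it.\<close>
  define f where "f x = (if x = top_face then top_face else \<alpha> x)" for x
  have \<alpha>S: "\<alpha> x \<in> ?S" if "x \<in> ?S" for x
    using automorphism_mem[OF \<alpha> that] .
  have f_S: "f x = \<alpha> x" if "x \<in> ?S" for x
    using that top_face_notin_facet_section[OF F] by (auto simp: f_def)
  have f_top: "f top_face = top_face"
    by (simp add: f_def)
  have TP: "T \<subseteq> P"
    using top_face by (auto simp: T_def S)
  have not_le: "\<not> le top_face x" if "x \<in> ?S" for x
    using that top_face face_antisym[of x top_face] top_face_notin_facet_section[OF F] by (auto simp: S)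
  have "f ` T \<subseteq> P"
    using \<alpha>S f_S f_top top_face by (auto simp: T_def S)
  moreover have "le (f x) (f y) \<longleftrightarrow> le x y" if "x \<in> T" "y \<in> T" for x y
  proof (cases "y = top_face")
    case True
    then show ?thesis
      using that \<open>f ` T \<subseteq> P\<close> TP f_top top_face(2) by auto
  next
    case False
    then have y: "y \<in> ?S"
      using that by (simp add: T_def)
    show ?thesis
    proof (cases "x = top_face")
      case True
      then show ?thesis
        using y not_le \<alpha>S f_S f_top by metis
    next
      case False
      then show ?thesis
        using that y f_S automorphism_le_iff[OF \<alpha>] by (simp add: T_def)
    qed
  qed
  ultimately have f: "embeds T f"
    using TP by (simp add: embeds_def)
  have flagT: "A \<subseteq> T" if "A \<in> flags P le" "F \<in> A" for A
    using flag_subset_facet_section[OF F that] by (simp add: T_def)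
  \<comment> \<open>Flags through \<open>F\<close> cover the section, so agreement on all of them is
    agreement on the whole section.\<close>
  have flag_through: "\<exists>A\<in>flags P le. x \<in> A \<and> F \<in> A" if "x \<in> ?S" for x
    using that chain_extends[of P "{x, F}"] FP face_refl by (auto simp: S is_chain_def)
  have FS: "F \<in> ?S"
    using FP face_refl by (simp add: S)
  obtain \<Phi> where \<Phi>: "\<Phi> \<in> flags P le" "F \<in> \<Phi>"
    using flag_through[OF FS] by blast
  \<comment> \<open>\<open>f F\<close> lies below \<open>F\<close> and has the same rank.\<close>
  have "f F = F"
    using embeds_rk[OF f \<Phi>(1) flagT[OF \<Phi>] \<Phi>(2)] rk_less[of "f F" F] \<alpha>S[OF FS] f_S[OF FS] FP
    by (auto simp: S)
  then have "F \<in> f ` \<Phi>"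
    using \<Phi>(2) by force
  then have "f ` \<Phi> \<in> flag_orbit P le \<Phi>"
    using trans F \<Phi> embeds_flag[OF f \<Phi>(1) flagT[OF \<Phi>]] by (simp add: facet_transitive_def)
  then obtain \<gamma> where \<gamma>: "\<gamma> \<in> automorphisms P le" "f ` \<Phi> = \<gamma> ` \<Phi>"
    by (auto simp: flag_orbit_def)
  have g: "embeds T \<gamma>"
    using automorphism_embeds[OF \<gamma>(1)] TP by (rule embeds_mono)
  have agree: "\<forall>x\<in>\<Phi>. f x = \<gamma> x"
    using embeds_eq_of_image_eq[OF f g \<Phi>(1) flagT[OF \<Phi>] \<gamma>(2)] by blast
  have "\<gamma> x = \<alpha> x" if x: "x \<in> ?S" for x
  proof -
    obtain \<Psi> where "\<Psi> \<in> flags P le" "x \<in> \<Psi>" "F \<in> \<Psi>"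
      using flag_through[OF x] by blast
    then have "f x = \<gamma> x"
      using embeds_agree[OF f g flagT \<Phi> _ _ agree] by blast
    then show ?thesis
      using f_S[OF x] by simp
  qed
  then show "\<exists>\<gamma>\<in>automorphisms P le. \<forall>x\<in>?S. \<gamma> x = \<alpha> x"
    using \<gamma>(1) by blast
qed

section \<open>Regularity and the two-orbit class\<close>

lemma regular_or_class_imp_facet_transitive:
  assumes "regular P le \<or> in_class_two {0..n - 2} n P le rk"
  shows facet_transitive
  using assms
proof
  assume "regular P le"
  then show ?thesis
    by (auto simp: facet_transitive_def regular_def)
next
  assume cls: "in_class_two {0..n - 2} n P le rk"
  show ?thesis
    unfolding facet_transitive_def
  proof (intro ballI impI)
    fix F \<Phi> \<Psi>
    assume F: "F \<in> facets n P rk"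
      and \<Phi>: "\<Phi> \<in> flags P le" "F \<in> \<Phi>" and \<Psi>: "\<Psi> \<in> flags P le" "F \<in> \<Psi>"
    from \<Phi>(1) \<Psi>(1) show "\<Psi> \<in> flag_orbit P le \<Phi>"
    proof (induction rule: flag_path_induct)
      case start
      show ?case
        using flag_orbit_refl flag_subset[OF \<Phi>(1)] .
    next
      case (step A B i)
      \<comment> \<open>\<open>F\<close> is a common face of rank \<open>n - 1\<close>, so the path
        never flips at that rank.\<close>
      have "i \<noteq> n - 1"
        using step \<Phi>(2) \<Psi>(2) facetD[OF F] by auto
      then have "i \<in> {0..n - 2}"
        using step by auto
      moreover have "B = flag_flip P le rk i A"
        using flip_rel_imp_eq flip_rel_flag_flip step by blast
      ultimately have "B \<in> flag_orbit P le A"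
        using cls step by (auto simp: in_class_two_def)
      then show ?case
        using flag_orbit_trans[OF flag_subset[OF \<Phi>(1)]] step by blast
    qed
  qed
qed

lemma facet_transitive_imp_regular_or_class:
  assumes trans: facet_transitive
  shows "regular P le \<or> in_class_two {0..n - 2} n P le rk"
proof -
  let ?O = "flag_orbit P le"
  \<comment> \<open>A flip of rank at most \<open>n - 2\<close> keeps the facet of the flag.\<close>
  have low: "B \<in> ?O A" if A: "A \<in> flags P le" and i: "i \<in> {0..n - 2}" and B: "flip_rel i A B" for A B i
  proof -
    obtain F where F: "F \<in> A" "rk F = n - 1"
      using flag_face[OF A, of "n - 1"] i by auto
    then have "F \<in> B" "F \<in> facets n P rk"
      using B i flag_subset[OF A] by (auto simp: flip_rel_def facets_def)
    then show ?thesis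
      using trans A B F by (auto simp: facet_transitive_def flip_rel_def)
  qed
  \<comment> \<open>The guard \<open>n \<ge> 1\<close> confines the second alternative to the case
    in which rank \<open>n - 1\<close> can be flipped.\<close>
  have two: "B \<in> ?O A \<or> (n \<ge> 1 \<and> B \<in> ?O (flag_flip P le rk (n - 1) A))"
    if A: "A \<in> flags P le" and B: "B \<in> flags P le" for A B
    using A B
  proof (induction rule: flag_path_induct)
    case start
    show ?case
      using flag_orbit_refl flag_subset[OF A] by blast
  next
    case (step C D i)
    let ?A' = "flag_flip P le rk (n - 1) A"
    show ?case
    proof (cases "i = n - 1")
      case True
      then have n: "n \<ge> 1" "n - 1 \<in> {0..n - 1}"
        using step by auto
      have A': "flip_rel (n - 1) A ?A'"
        using flip_rel_flag_flip[OF A n(2)] .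
      then have "?A' \<in> flags P le" "flip_rel (n - 1) ?A' A"
        using flip_rel_sym[OF A] by (auto simp: flip_rel_def)
      \<comment> \<open>A flip of rank \<open>n - 1\<close> interchanges the two alternatives: from
        the orbit of \<open>A\<close> it leads to that of \<open>?A'\<close>, and back.\<close>
      then show ?thesis
        using step.IH flip_rel_flag_orbit[OF A _ n(2) A', of C D]
          flip_rel_flag_orbit[of ?A' C "n - 1" A D] step n True by blast
    next
      case False
      then have "i \<in> {0..n - 2}"
        using step by auto
      then have "D \<in> ?O C"
        using low[of C i D] step by blast
      moreover have "n \<ge> 1 \<Longrightarrow> ?A' \<subseteq> P"
        using flip_rel_flag_flip[OF A, of "n - 1"] flag_subset by (auto simp: flip_rel_def)
      ultimately show ?thesis
        using step.IH flag_orbit_trans flag_subset[OF A] by blast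
    qed
  qed
  show ?thesis
  \<comment> \<open>One flag in the orbit of its own flip of rank \<open>n - 1\<close> already
    merges the two orbits. For \<open>n \<le> 0\<close> there are no flips, and \<open>two\<close>
    leaves a single orbit.\<close>
  proof (cases "\<exists>A\<in>flags P le. n \<le> 0 \<or> flag_flip P le rk (n - 1) A \<in> ?O A")
    case True
    then obtain A where A: "A \<in> flags P le" "n \<le> 0 \<or> flag_flip P le rk (n - 1) A \<in> ?O A"
      by blast
    have all: "B \<in> ?O A" if "B \<in> flags P le" for B
      using two[OF A(1) that] A(2) flag_orbit_trans[OF flag_subset[OF A(1)]] by auto
    have "C \<in> ?O B" if "B \<in> flags P le" "C \<in> flags P le" for B C
      using all[OF that(1)] all[OF that(2)] flag_orbit_eq[OF flag_subset[OF A(1)]] by blast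
    then show ?thesis
      by (auto simp: regular_def)
  next
    case False
    obtain A where A: "A \<in> flags P le"
      using chain_extends[of P "{}"] by (auto simp: is_chain_def)
    have n: "n \<ge> 1" "n - 1 \<in> {0..n - 1}"
      using False A by force+
    let ?A' = "flag_flip P le rk (n - 1) A"
    have A': "?A' \<in> flags P le"
      using flip_rel_flag_flip[OF A n(2)] by (simp add: flip_rel_def)
    have "?O ` flags P le = {?O A, ?O ?A'}"
      using two[OF A] flag_orbit_eq flag_subset A A' by blast
    moreover have "?O A \<noteq> ?O ?A'"
      using False A flag_orbit_refl[OF flag_subset[OF A']] by blast
    ultimately have "two_orbit P le"
      by (simp add: two_orbit_def)
    \<comment> \<open>Ranks up to \<open>n - 2\<close> are settled by \<open>low\<close>; for rank
      \<open>n - 1\<close> the negated case assumption holds for every flag, not only for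
      \<open>A\<close>.\<close>
    moreover have "flag_flip P le rk i B \<in> ?O B \<longleftrightarrow> i \<in> {0..n - 2}"
      if B: "B \<in> flags P le" and i: "i \<in> {0..n - 1}" for B i
      using low[OF B _ flip_rel_flag_flip[OF B i]] False B i by (cases "i = n - 1") auto
    ultimately show ?thesis
      by (auto simp: in_class_two_def)
  qed
qed

end

theorem theorem2:
  fixes n :: int
    and P :: "'a set"
    and le :: "'a \<Rightarrow> 'a \<Rightarrow> bool"
    and rk :: "'a \<Rightarrow> int"
  assumes "abstract_polytope n P le rk"
    and "\<And>F. F \<in> facets n P rk \<Longrightarrow> regular (facet_section P le F) le"
  shows "hereditary n P le rk \<longleftrightarrow>
           regular P le \<or> in_class_two {0..n - 2} n P le rk"
proof -
  interpret abstract_polytope n P le rk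
    by (rule assms(1))
  show ?thesis
    using hereditary_imp_facet_transitive assms(2) facet_transitive_imp_hereditary
      regular_or_class_imp_facet_transitive facet_transitive_imp_regular_or_class by blast
qed

end
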